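(* Let $\phi$ be a window satisfying the assumption below and such that $$\inf_{\xi\in(-1/3,1/3)}|\hat\phi(\xi)|\ge\delta>0,\qquad \sup_{\xi\in(-1/3,1/3)}|\hat\phi(\xi)|\le M<\infty.$$ Then the family $\{F^\phi_{p,\tau}: p\in\mathbb Z,\ \tau=0,\dots,\beta(|p|)-1\}$ is a frame of $L^2([0,1])$; more precisely, for all $f\in L^2([0,1])$, $$\Big(\frac{\delta}{M}\Big)^2\|f\|^2_{L^2([0,1])}\le\sum_{p,\tau}\big|(f,F^\phi_{p,\tau})_{L^2([0,1])}\big|^2\le\Big(\frac{M}{\delta}\Big)^2\|f\|^2_{L^2([0,1])}.$$
   Context: Fourier transform on $\mathbb R$: $\hat\phi(\xi)=(2\pi)^{-1/2}\int e^{-2\pi it\xi}\phi(t)dt$. Assumption on $\phi$: $\hat\phi\in L^\infty(\mathbb R)$, $\hat\phi|_{(-1/3,1/3)}$ continuous, $\hat\phi(\xi)\ne0$ for $|\xi|<\frac13$, $\hat\phi(\xi)=0$ for a.e. $|\xi|>\frac13$, and $\lim_{\xi\to-1/3^+}\hat\phi(\xi)$ exists and is finite. Define $\nu,\beta$ by $\nu(0)=0,\beta(0)=1$; $\nu(1)=1,\beta(1)=1$; for $p\ge2$, $\nu(p)=2^{p-1}+2^{p-2}$, $\beta(p)=2^{p-1}$; $\nu(-p)=-\nu(p)$, $\beta(-p)=\beta(p)$. For $p\ge1$ and $j=0,\dots,\beta(p)-1$ let $c^\phi_{p,j}=\overline{\hat\phi\big(\frac{\beta(p)+j}{\nu(p)}-1\big)}$,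 where $\hat\phi(-\frac13)$ is understood as $\lim_{\xi\to-1/3^+}\hat\phi(\xi)$ (the arguments lie in $[-\frac13,\frac13)$). The window-adapted functions are, for $p\ge1$, $\tau=0,\dots,\beta(p)-1$, $$E^\phi_{p,\tau}(t)=\frac{1}{\sqrt{\beta(p)}}\sum_{j=0}^{\beta(p)-1}\big[c^\phi_{p,j}\big]^{-1}e^{2\pi i(\beta(p)+j)(t-\tau/\beta(p))},$$ with $E^\phi_{0,0}=1$ and $E^\phi_{p,\tau}=\overline{E^\phi_{-p,\tau}}$ for $p<0$; and $F^\phi_{p,\tau}=E^\phi_{p,\tau}/\|E^\phi_{p,\tau}\|_{L^2([0,1])}$. Inner product $(f,g)_{L^2([0,1])}=\int_0^1 f\bar g\,dt$. *)

theory Defs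
  imports "HOL-Analysis.Analysis"
begin

definition beta :: "int \<Rightarrow> nat" where
  "beta p = (if \<bar>p\<bar> \<le> 1 then 1 else 2 ^ (nat \<bar>p\<bar> - 1))"

definition nu :: "int \<Rightarrow> int" where
  "nu p = (if p = 0 then 0 else if \<bar>p\<bar> = 1 then p
           else sgn p * (2 ^ (nat \<bar>p\<bar> - 1) + 2 ^ (nat \<bar>p\<bar> - 2)))"

text \<open>The Fourier transform of the window, with its value at -1/3 replaced by
  the right limit there.\<close>
definition phat_ext :: "(real \<Rightarrow> complex) \<Rightarrow> real \<Rightarrow> complex" where
  "phat_ext g \<xi> = (if \<xi> = -1/3 then Lim (at_right (-1/3)) g else g \<xi>)"

definition coef :: "(real \<Rightarrow> complex) \<Rightarrow> int \<Rightarrow> nat \<Rightarrow> complex" where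
  "coef g p j = cnj (phat_ext g ((real (beta p) + real j) / real_of_int (nu p) - 1))"

definition Epos :: "(real \<Rightarrow> complex) \<Rightarrow> int \<Rightarrow> nat \<Rightarrow> real \<Rightarrow> complex" where
  "Epos g p \<tau> t = complex_of_real (1 / sqrt (real (beta p))) *
     (\<Sum>j<beta p. inverse (coef g p j) *
        exp (2 * pi * \<i> * of_nat (beta p + j) * complex_of_real (t - real \<tau> / real (beta p))))"

definition Ewin :: "(real \<Rightarrow> complex) \<Rightarrow> int \<Rightarrow> nat \<Rightarrow> real \<Rightarrow> complex" where
  "Ewin g p \<tau> t = (if p = 0 then 1 else if p > 0 then Epos g p \<tau> t else cnj (Epos g (- p) \<tau> t))"

definition L2norm01 :: "(real \<Rightarrow> complex) \<Rightarrow> real" where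
  "L2norm01 f = sqrt (integral\<^sup>L (lebesgue_on {0..1}) (\<lambda>t. (norm (f t))\<^sup>2))"

definition inner01 :: "(real \<Rightarrow> complex) \<Rightarrow> (real \<Rightarrow> complex) \<Rightarrow> complex" where
  "inner01 f h = integral\<^sup>L (lebesgue_on {0..1}) (\<lambda>t. f t * cnj (h t))"

definition Fwin :: "(real \<Rightarrow> complex) \<Rightarrow> int \<Rightarrow> nat \<Rightarrow> real \<Rightarrow> complex" where
  "Fwin g p \<tau> t = Ewin g p \<tau> t / complex_of_real (L2norm01 (Ewin g p \<tau>))"

end

theory Submission
  imports Defs
begin

text \<open>Since \<open>\<beta>(p) + j\<close>, \<open>0 \<le> j < \<beta>(p)\<close>, runs through one dyadic block of frequencies, the
  frequencies occurring in the functions \<open>E\<^sub>p\<^sub>,\<^sub>\<tau>\<close> partition the integers. For fixed \<open>p\<close>, the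
  coefficients \<open>(f, E\<^sub>p\<^sub>,\<^sub>\<tau>)\<close> are a discrete Fourier transform in \<open>\<tau>\<close> of the Fourier coefficients
  of \<open>f\<close> in that block, each divided by a window value of modulus between \<open>\<delta>\<close> and \<open>M\<close>. The finite
  Parseval identity therefore bounds the sum over \<open>\<tau>\<close> by the energy of \<open>f\<close> in the block, and
  Parseval's identity on \<open>[0,1]\<close> adds up the blocks. The latter needs the density of the
  trigonometric polynomials in \<open>L\<^sup>2\<close>, obtained from Stone--Weierstrass on the circle.\<close>

section \<open>Exponentials and square-integrable functions\<close>

definition fexp :: "int \<Rightarrow> real \<Rightarrow> complex" where
  "fexp n t = cis (2 * pi * real_of_int n * t)"

lemma fexp_0 [simp]: "fexp 0 t = 1"
  by (simp add: fexp_def)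

lemma fexp_add: "fexp (m + n) t = fexp m t * fexp n t"
  by (simp add: fexp_def cis_mult algebra_simps)

lemma cnj_fexp: "cnj (fexp n t) = fexp (- n) t"
  by (simp add: fexp_def cis_cnj)

lemma norm_fexp [simp]: "norm (fexp n t) = 1"
  by (simp add: fexp_def)

lemma continuous_on_fexp [continuous_intros]: "continuous_on S (fexp n)"
  unfolding fexp_def cis_conv_exp by (intro continuous_intros)

lemma fexp_int_shift: "fexp n (t + of_int k) = fexp n t"
proof -
  have "fexp n (t + of_int k) = cis (2 * pi * real_of_int n * t) * cis (2 * pi * real_of_int (n * k))"
    by (simp add: fexp_def cis_mult algebra_simps)
  also have "cis (2 * pi * real_of_int (n * k)) = 1"
    by (rule cis_multiple_2pi) auto
  finally show ?thesis by (simp add: fexp_def)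
qed

abbreviation (input) leb01 :: "real measure" where
  "leb01 \<equiv> lebesgue_on {0..1}"

lemma measure_leb01 [simp]: "measure leb01 {0..1} = 1"
  by (simp add: measure_restrict_space)

lemma integral_fexp: "integral\<^sup>L leb01 (fexp n) = (if n = 0 then 1 else 0)"
proof (cases "n = 0")
  case True
  then have "fexp n = (\<lambda>t. 1)" by auto
  then show ?thesis using True by simp
next
  case False
  define c where "c = 2 * pi * \<i> * of_int n"
  have c: "c \<noteq> 0" using False by (simp add: c_def)
  have e: "fexp n t = exp (c * of_real t)" for t
    by (simp add: fexp_def cis_conv_exp c_def mult_ac)
  have "((\<lambda>t. exp (c * of_real t) / c) has_vector_derivative exp (c * of_real t)) (at t within {0..1})" for t :: real
    by (rule has_vector_derivative_real_field[of "\<lambda>z. exp (c * z) / c"])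
       (use c in \<open>auto intro!: derivative_eq_intros\<close>)
  then have "((\<lambda>t. exp (c * of_real t)) has_integral (exp (c * of_real 1) / c - exp (c * of_real 0) / c)) {0..1}"
    by (intro fundamental_theorem_of_calculus) auto
  moreover have "exp (c * of_real 1) = exp (c * of_real 0)"
    using fexp_int_shift[of n 0 1] by (simp add: e)
  ultimately have "integral {0..1} (fexp n) = 0"
    by (simp add: e[abs_def] integral_unique)
  then show ?thesis
    using False by (simp add: lebesgue_integral_eq_integral continuous_imp_integrable_real continuous_on_fexp)
qed

definition square_integrable :: "'a measure \<Rightarrow> ('a \<Rightarrow> complex) \<Rightarrow> bool" where
  "square_integrable M f \<longleftrightarrow> f \<in> borel_measurable M \<and> integrable M (\<lambda>t. (norm (f t))\<^sup>2)"

lemma square_integrable_measurable [measurable_dest]: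
  "square_integrable M f \<Longrightarrow> f \<in> borel_measurable M"
  by (simp add: square_integrable_def)

lemma norm_add_power2_le:
  fixes a b :: "'a::real_normed_vector"
  shows "(norm (a + b))\<^sup>2 \<le> 2 * (norm a)\<^sup>2 + 2 * (norm b)\<^sup>2"
proof -
  have "(norm (a + b))\<^sup>2 \<le> (norm a + norm b)\<^sup>2"
    by (intro power_mono norm_triangle_ineq) auto
  also have "\<dots> \<le> 2 * (norm a)\<^sup>2 + 2 * (norm b)\<^sup>2"
    using zero_le_power2[of "norm a - norm b"] by (simp add: power2_eq_square algebra_simps)
  finally show ?thesis .
qed

lemma square_integrable_add:
  assumes "square_integrable M f" "square_integrable M g"
  shows "square_integrable M (\<lambda>t. f t + g t)"
proof -
  note [measurable] = assms[THEN square_integrable_measurable]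
  have "integrable M (\<lambda>t. (norm (f t + g t))\<^sup>2)"
    by (rule Bochner_Integration.integrable_bound[of _ "\<lambda>t. 2 * (norm (f t))\<^sup>2 + 2 * (norm (g t))\<^sup>2"])
       (use assms norm_add_power2_le in \<open>auto simp: square_integrable_def\<close>)
  then show ?thesis
    by (simp add: square_integrable_def)
qed

lemma square_integrable_cmult:
  "square_integrable M f \<Longrightarrow> square_integrable M (\<lambda>t. c * f t)"
  by (auto simp: square_integrable_def norm_mult power_mult_distrib)

lemma square_integrable_diff:
  assumes "square_integrable M f" "square_integrable M g"
  shows "square_integrable M (\<lambda>t. f t - g t)"
  using square_integrable_add[OF assms(1) square_integrable_cmult[OF assms(2), of "-1"]] by simp

lemma square_integrable_cnj:
  "square_integrable M f \<Longrightarrow> square_integrable M (\<lambda>t. cnj (f t))"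
  using measurable_compose_rev[OF borel_measurable_continuous_onI[OF continuous_on_cnj[OF continuous_on_id]]]
  by (auto simp: square_integrable_def)

lemma square_integrable_mult_cnj:
  assumes "square_integrable M f" "square_integrable M g"
  shows "integrable M (\<lambda>t. f t * cnj (g t))"
proof (rule Bochner_Integration.integrable_bound[of _ "\<lambda>t. (norm (f t))\<^sup>2 + (norm (g t))\<^sup>2"])
  note [measurable] = assms(1)[THEN square_integrable_measurable]
    square_integrable_cnj[OF assms(2), THEN square_integrable_measurable]
  show "(\<lambda>t. f t * cnj (g t)) \<in> borel_measurable M" by measurable
  have "x * y \<le> x\<^sup>2 + y\<^sup>2" if "0 \<le> x" "0 \<le> y" for x y :: real
    using zero_le_power2[of "x - y"] mult_nonneg_nonneg[OF that]
    unfolding power2_diff by linarith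
  then show "AE t in M. norm (f t * cnj (g t)) \<le> norm ((norm (f t))\<^sup>2 + (norm (g t))\<^sup>2)"
    by (auto simp: norm_mult)
qed (use assms in \<open>auto simp: square_integrable_def\<close>)

lemma square_integrable_continuous:
  assumes "continuous_on {0..1} f"
  shows "square_integrable leb01 f"
  unfolding square_integrable_def
  by (intro conjI continuous_imp_measurable_on_sets_lebesgue continuous_imp_integrable_real
      continuous_intros assms) auto

lemma square_integrable_fexp: "square_integrable leb01 (fexp n)"
  by (intro square_integrable_continuous continuous_intros)

lemma square_integrable_fexp_sum:
  "square_integrable leb01 (\<lambda>t. \<Sum>n\<in>A. c n * fexp n t)"
  by (intro square_integrable_continuous continuous_intros)

lemma inner01_diff_left:
  assumes "square_integrable leb01 f" "square_integrable leb01 g" "square_integrable leb01 h"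
  shows "inner01 (\<lambda>t. f t - g t) h = inner01 f h - inner01 g h"
  using assms unfolding inner01_def
  by (simp add: left_diff_distrib square_integrable_mult_cnj)

lemma inner01_sum_left:
  assumes "\<And>i. i \<in> A \<Longrightarrow> square_integrable leb01 (f i)" "square_integrable leb01 h"
  shows "inner01 (\<lambda>t. \<Sum>i\<in>A. c i * f i t) h = (\<Sum>i\<in>A. c i * inner01 (f i) h)"
  using assms unfolding inner01_def
  by (simp add: sum_distrib_right mult.assoc square_integrable_mult_cnj)

lemma inner01_commute: "inner01 f g = cnj (inner01 g f)"
  unfolding inner01_def Bochner_Integration.integral_cnj[symmetric] by (simp add: mult.commute)

lemma inner01_sum_right:
  assumes "\<And>i. i \<in> A \<Longrightarrow> square_integrable leb01 (f i)" "square_integrable leb01 h"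
  shows "inner01 h (\<lambda>t. \<Sum>i\<in>A. c i * f i t) = (\<Sum>i\<in>A. cnj (c i) * inner01 h (f i))"
  using inner01_sum_left[OF assms, where c = c]
  by (subst inner01_commute) (simp add: inner01_commute[of h])

lemma inner01_fexp: "inner01 (fexp m) (fexp n) = (if m = n then 1 else 0)"
  unfolding inner01_def by (simp add: cnj_fexp fexp_add[symmetric] integral_fexp)

lemma L2norm01_power2: "(L2norm01 f)\<^sup>2 = integral\<^sup>L leb01 (\<lambda>t. (norm (f t))\<^sup>2)"
  by (simp add: L2norm01_def)

lemma L2norm01_diff_fexp:
  assumes f: "square_integrable leb01 f"
  shows "(L2norm01 (\<lambda>t. f t - c * fexp n t))\<^sup>2
    = (L2norm01 f)\<^sup>2 + ((norm (inner01 f (fexp n) - c))\<^sup>2 - (norm (inner01 f (fexp n)))\<^sup>2)"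
proof -
  define a where "a = inner01 f (fexp n)"
  have i: "integrable leb01 (\<lambda>t. f t * cnj (fexp n t))"
    by (intro square_integrable_mult_cnj f square_integrable_fexp)
  have norm_diff: "(norm (x - y))\<^sup>2 = (norm x)\<^sup>2 - 2 * Re (cnj y * x) + (norm y)\<^sup>2" for x y :: complex
    unfolding cmod_power2 by (simp add: power2_eq_square algebra_simps)
  have pt: "(norm (f t - c * fexp n t))\<^sup>2 = (norm (f t))\<^sup>2 - 2 * Re (cnj c * (f t * cnj (fexp n t))) + (norm c)\<^sup>2" for t
    by (subst norm_diff) (simp add: norm_mult mult_ac)
  have "(L2norm01 (\<lambda>t. f t - c * fexp n t))\<^sup>2 = (L2norm01 f)\<^sup>2
      - 2 * integral\<^sup>L leb01 (\<lambda>t. Re (cnj c * (f t * cnj (fexp n t)))) + (norm c)\<^sup>2"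
    using f i unfolding L2norm01_power2 pt square_integrable_def
    by (simp del: times_complex.sel)
  also have "integral\<^sup>L leb01 (\<lambda>t. Re (cnj c * (f t * cnj (fexp n t)))) = Re (cnj c * a)"
    using i by (simp add: a_def inner01_def del: times_complex.sel)
  also have "(L2norm01 f)\<^sup>2 - 2 * Re (cnj c * a) + (norm c)\<^sup>2
     = (L2norm01 f)\<^sup>2 + ((norm (a - c))\<^sup>2 - (norm a)\<^sup>2)"
    by (simp add: norm_diff)
  finally show ?thesis by (simp add: a_def)
qed

lemma L2norm01_diff_fexp_sum:
  assumes f: "square_integrable leb01 f" and A: "finite A"
  shows "(L2norm01 (\<lambda>t. f t - (\<Sum>n\<in>A. c n * fexp n t)))\<^sup>2
    = (L2norm01 f)\<^sup>2
      + (\<Sum>n\<in>A. (norm (inner01 f (fexp n) - c n))\<^sup>2 - (norm (inner01 f (fexp n)))\<^sup>2)"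
  using A
proof (induction A rule: finite_induct)
  case (insert n A)
  define h where "h = (\<lambda>t. f t - (\<Sum>n\<in>A. c n * fexp n t))"
  have h: "square_integrable leb01 h"
    unfolding h_def by (intro square_integrable_diff f square_integrable_fexp_sum)
  have "inner01 h (fexp n) = inner01 f (fexp n) - (\<Sum>k\<in>A. c k * inner01 (fexp k) (fexp n))"
    unfolding h_def using f
    by (simp add: inner01_diff_left inner01_sum_left square_integrable_fexp square_integrable_fexp_sum)
  also have "\<dots> = inner01 f (fexp n)"
    using insert.hyps by (auto simp: inner01_fexp intro!: sum.neutral)
  finally have "inner01 h (fexp n) = inner01 f (fexp n)" .
  moreover have "(\<lambda>t. f t - (\<Sum>n\<in>insert n A. c n * fexp n t)) = (\<lambda>t. h t - c n * fexp n t)"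
    using insert.hyps by (simp add: h_def algebra_simps)
  ultimately show ?case
    using L2norm01_diff_fexp[OF h, of "c n" n] insert.IH insert.hyps
    by (simp add: h_def[symmetric])
qed simp

lemma L2norm01_fexp_sum:
  assumes "finite A"
  shows "(L2norm01 (\<lambda>t. \<Sum>n\<in>A. c n * fexp n t))\<^sup>2 = (\<Sum>n\<in>A. (norm (c n))\<^sup>2)"
proof -
  have "square_integrable leb01 (\<lambda>t. 0)"
    by (simp add: square_integrable_def)
  from L2norm01_diff_fexp_sum[OF this assms, of c] show ?thesis
    by (simp add: L2norm01_power2 inner01_def)
qed

section \<open>Density of trigonometric polynomials\<close>

inductive trig_poly :: "(real \<Rightarrow> complex) \<Rightarrow> bool" where
  zero: "trig_poly (\<lambda>t. 0)"
| step: "trig_poly q \<Longrightarrow> trig_poly (\<lambda>t. c * fexp n t + q t)"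

lemma trig_poly_add: "trig_poly p \<Longrightarrow> trig_poly q \<Longrightarrow> trig_poly (\<lambda>t. p t + q t)"
proof (induction rule: trig_poly.induct)
  case (step p c n)
  then show ?case
    using trig_poly.step[of "\<lambda>t. p t + q t" c n] by (simp add: add.assoc)
qed simp

lemma trig_poly_monom: "trig_poly (\<lambda>t. c * fexp n t)"
  using trig_poly.step[OF trig_poly.zero, of c n] by simp

lemma trig_poly_const: "trig_poly (\<lambda>t. c)"
  using trig_poly_monom[of c 0] by simp

lemma trig_poly_monom_mult: "trig_poly q \<Longrightarrow> trig_poly (\<lambda>t. c * fexp n t * q t)"
proof (induction rule: trig_poly.induct)
  case (step q d m)
  then show ?case
    using trig_poly.step[of "\<lambda>t. c * fexp n t * q t" "c * d" "n + m"]
    by (simp add: fexp_add algebra_simps)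
qed (simp add: trig_poly.zero)

lemma trig_poly_mult: "trig_poly p \<Longrightarrow> trig_poly q \<Longrightarrow> trig_poly (\<lambda>t. p t * q t)"
proof (induction rule: trig_poly.induct)
  case (step p c n)
  then show ?case
    using trig_poly_add[OF trig_poly_monom_mult[of q c n], of "\<lambda>t. p t * q t"]
    by (simp add: algebra_simps)
qed (simp add: trig_poly.zero)

lemma trig_poly_imp_sum:
  assumes "trig_poly q"
  obtains A c where "finite A" "q = (\<lambda>t. \<Sum>n\<in>A. c n * fexp n t)"
proof -
  have "\<exists>A c. finite A \<and> q = (\<lambda>t. \<Sum>n\<in>A. c n * fexp n t)"
    using assms
  proof (induction rule: trig_poly.induct)
    case zero
    show ?case by (intro exI[of _ "{}"]) simp
  next
    case (step q d m)
    then obtain A c where A: "finite A" "q = (\<lambda>t. \<Sum>n\<in>A. c n * fexp n t)" by blast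
    define c' where "c' = (\<lambda>k. (if k \<in> A then c k else 0) + (if k = m then d else 0))"
    have "(\<Sum>n\<in>insert m A. c' n * fexp n t) = d * fexp m t + q t" for t
    proof -
      have "(\<Sum>n\<in>insert m A. c' n * fexp n t)
        = (\<Sum>n\<in>insert m A. (if n \<in> A then c n * fexp n t else 0))
          + (\<Sum>n\<in>insert m A. (if n = m then d * fexp n t else 0))"
        unfolding sum.distrib[symmetric] by (rule sum.cong) (auto simp: c'_def algebra_simps)
      also have "(\<Sum>n\<in>insert m A. (if n \<in> A then c n * fexp n t else 0)) = q t"
        unfolding A using A(1) by (intro sum.mono_neutral_cong_right) auto
      also have "(\<Sum>n\<in>insert m A. (if n = m then d * fexp n t else 0)) = d * fexp m t"
        using A(1) by (subst sum.delta) auto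
      finally show ?thesis by simp
    qed
    then show ?case using A(1) by (intro exI[of _ "insert m A"] exI[of _ c']) auto
  qed
  then show thesis using that by blast
qed

lemma trig_poly_real_polynomial:
  assumes "real_polynomial_function (p :: complex \<Rightarrow> real)"
  shows "trig_poly (\<lambda>t. of_real (p (fexp 1 t)))"
  using assms
proof (induction rule: real_polynomial_function.induct)
  case (linear p)
  interpret bounded_linear p by fact
  have *: "p z = Re z * p 1 + Im z * p \<i>" for z
  proof -
    have "z = Re z *\<^sub>R 1 + Im z *\<^sub>R \<i>" by (simp add: complex_eq_iff)
    then have "p z = p (Re z *\<^sub>R 1 + Im z *\<^sub>R \<i>)" by simp
    then show ?thesis by (simp only: add scaleR real_scaleR_def)
  qed
  have "of_real (p (fexp 1 t)) = (of_real (p 1) / 2 + of_real (p \<i>) / (2 * \<i>)) * fexp 1 t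
     + (of_real (p 1) / 2 - of_real (p \<i>) / (2 * \<i>)) * fexp (-1) t" for t
    unfolding *[of "fexp 1 t"] cnj_fexp[symmetric] by (simp add: complex_eq_iff field_simps)
  then show ?case
    by (simp only: trig_poly_add[OF trig_poly_monom trig_poly_monom])
qed (auto intro: trig_poly_const trig_poly_add trig_poly_mult)

lemma trig_poly_polynomial:
  assumes "polynomial_function (p :: complex \<Rightarrow> complex)"
  shows "trig_poly (\<lambda>t. p (fexp 1 t))"
proof -
  have "real_polynomial_function (\<lambda>z. Re (p z))" "real_polynomial_function (\<lambda>z. Im (p z))"
    using assms bounded_linear_Re bounded_linear_Im by (auto simp: polynomial_function_def o_def)
  then have "trig_poly (\<lambda>t. of_real (Re (p (fexp 1 t))) + \<i> * of_real (Im (p (fexp 1 t))))"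
    by (intro trig_poly_add trig_poly_mult trig_poly_const trig_poly_real_polynomial[of "\<lambda>z. Re (p z)"]
        trig_poly_real_polynomial[of "\<lambda>z. Im (p z)"])
  then show ?thesis by (simp add: complex_eq[symmetric])
qed

text \<open>The map \<open>t \<mapsto> fexp 1 t\<close> from the compact interval onto the circle is closed,
  so a continuous function with equal end values descends to the circle.\<close>

lemma continuous_periodic_approx_trig_poly:
  assumes g: "continuous_on {0..1} g" "g 0 = g 1" and "0 < e"
  obtains q where "trig_poly q" "\<And>t. t \<in> {0..1} \<Longrightarrow> norm (g t - q t) < e"
proof -
  define G where "G z = g (Arg2pi z / (2 * pi))" for z
  have G: "G (fexp 1 t) = g t" if "t \<in> {0..1}" for t
  proof (cases "t = 1")
    case True
    then have "fexp 1 t = 1" using fexp_int_shift[of 1 0 1] by (simp add: fexp_def)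
    then show ?thesis using g(2) True Arg2pi_of_real[of 1] by (simp add: G_def)
  next
    case False
    then have "Arg2pi (fexp 1 t) = 2 * pi * t"
      using that by (intro Arg2pi_unique[of 1]) (auto simp: fexp_def cis_conv_exp mult_ac)
    then show ?thesis by (simp add: G_def)
  qed
  have onto: "\<exists>t\<in>{0..1}. z = fexp 1 t" if "norm z = 1" for z
  proof
    show "z = fexp 1 (Arg2pi z / (2 * pi))"
      using that Arg2pi_eq[of z] by (simp add: fexp_def cis_conv_exp)
    show "Arg2pi z / (2 * pi) \<in> {0..1}"
      using Arg2pi_ge_0[of z] Arg2pi_lt_2pi[of z] by (simp add: field_simps)
  qed
  have "closed (G -` B \<inter> sphere 0 1)" if B: "closed B" for B
  proof -
    have "G -` B \<inter> sphere 0 1 = fexp 1 ` ({0..1} \<inter> g -` B)"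
    proof (intro set_eqI iffI)
      fix z assume z: "z \<in> G -` B \<inter> sphere 0 1"
      then obtain t where "t \<in> {0..1}" "z = fexp 1 t" using onto[of z] by auto
      then show "z \<in> fexp 1 ` ({0..1} \<inter> g -` B)" using z G[of t] by auto
    qed (use G in \<open>auto simp: image_iff\<close>)
    moreover have "compact ({0..1} \<inter> g -` B)"
      using continuous_on_closed_vimage[of "{0..1}" g] g(1) B
      by (simp add: Int_commute compact_eq_bounded_closed bounded_Int)
    ultimately show ?thesis
      by (simp add: compact_imp_closed compact_continuous_image continuous_on_fexp)
  qed
  then have "continuous_on (sphere 0 1) G"
    by (subst continuous_on_closed_vimage) auto
  then obtain p where p: "polynomial_function p" "\<And>z. z \<in> sphere 0 1 \<Longrightarrow> norm (G z - p z) < e"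
    using Stone_Weierstrass_polynomial_function[of "sphere 0 1" G e] \<open>0 < e\<close> by auto
  show thesis
  proof
    show "trig_poly (\<lambda>t. p (fexp 1 t))" using p(1) by (rule trig_poly_polynomial)
    show "norm (g t - p (fexp 1 t)) < e" if "t \<in> {0..1}" for t
      using p(2)[of "fexp 1 t"] G[OF that] by simp
  qed
qed

lemma L2norm01_bound:
  assumes "\<And>t. t \<in> {0..1} \<Longrightarrow> norm (f t) \<le> e" "f \<in> borel_measurable leb01"
  shows "(L2norm01 f)\<^sup>2 \<le> e\<^sup>2"
proof -
  note [measurable] = assms(2)
  have le: "(norm (f t))\<^sup>2 \<le> e\<^sup>2" if "t \<in> {0..1}" for t
    using assms(1)[OF that] by (intro power_mono) auto
  have "integral\<^sup>L leb01 (\<lambda>t. (norm (f t))\<^sup>2) \<le> integral\<^sup>L leb01 (\<lambda>t. e\<^sup>2)"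
  proof (rule integral_mono)
    show "integrable leb01 (\<lambda>t. (norm (f t))\<^sup>2)"
      by (rule Bochner_Integration.integrable_bound[of _ "\<lambda>t. e\<^sup>2"])
         (use le in auto)
  qed (use le in auto)
  then show ?thesis by (simp add: L2norm01_power2)
qed

lemma L2norm01_triangle_power2:
  assumes "square_integrable leb01 (\<lambda>t. f t - g t)" "square_integrable leb01 (\<lambda>t. g t - h t)"
  shows "(L2norm01 (\<lambda>t. f t - h t))\<^sup>2
    \<le> 2 * (L2norm01 (\<lambda>t. f t - g t))\<^sup>2 + 2 * (L2norm01 (\<lambda>t. g t - h t))\<^sup>2"
proof -
  have "square_integrable leb01 (\<lambda>t. f t - h t)"
    using square_integrable_add[OF assms] by simp
  moreover have "(norm (f t - h t))\<^sup>2 \<le> 2 * (norm (f t - g t))\<^sup>2 + 2 * (norm (g t - h t))\<^sup>2" for t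
    using norm_add_power2_le[of "f t - g t" "g t - h t"] by simp
  ultimately have "integral\<^sup>L leb01 (\<lambda>t. (norm (f t - h t))\<^sup>2)
     \<le> integral\<^sup>L leb01 (\<lambda>t. 2 * (norm (f t - g t))\<^sup>2 + 2 * (norm (g t - h t))\<^sup>2)"
    using assms by (intro integral_mono) (auto simp: square_integrable_def)
  also have "\<dots> = 2 * (L2norm01 (\<lambda>t. f t - g t))\<^sup>2 + 2 * (L2norm01 (\<lambda>t. g t - h t))\<^sup>2"
    using assms by (simp add: L2norm01_power2 square_integrable_def)
  finally show ?thesis by (simp add: L2norm01_power2)
qed

lemma square_integrable_approx_bounded:
  assumes f: "square_integrable leb01 f" and "0 < e"
  obtains K h where "h \<in> borel_measurable leb01" "\<And>t. norm (h t) \<le> K" "0 \<le> K"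
    "(L2norm01 (\<lambda>t. f t - h t))\<^sup>2 < e"
proof -
  define P where "P n = closest_point (cball (0::complex) (real n))" for n :: nat
  have P: "P n z \<in> cball 0 (real n)" for n z
    unfolding P_def by (intro closest_point_in_set) auto
  have P_le: "norm (z - P n z) \<le> norm z" for n z
    using closest_point_le[of "cball 0 (real n)" 0 z] by (simp add: P_def dist_norm)
  have cP: "continuous_on UNIV (P n)" for n
    unfolding P_def by (intro continuous_on_closest_point) auto
  note [measurable] = f[THEN square_integrable_measurable]
  have [measurable]: "(\<lambda>t. P n (f t)) \<in> borel_measurable leb01" for n
    by (rule measurable_compose_rev[OF borel_measurable_continuous_onI[OF cP]]) measurable
  have "(\<lambda>n. integral\<^sup>L leb01 (\<lambda>t. (norm (f t - P n (f t)))\<^sup>2)) \<longlonglongrightarrow> integral\<^sup>L leb01 (\<lambda>t. 0)"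
  proof (rule integral_dominated_convergence[where w = "\<lambda>t. (norm (f t))\<^sup>2"])
    have "(\<lambda>n. (norm (z - P n z))\<^sup>2) \<longlonglongrightarrow> 0" for z
    proof (rule tendsto_eventually)
      show "\<forall>\<^sub>F n in sequentially. (norm (z - P n z))\<^sup>2 = 0"
        using eventually_ge_at_top[of "nat \<lceil>norm z\<rceil>"]
      proof eventually_elim
        case (elim n)
        then have "norm z \<le> real n" by linarith
        then have "z \<in> cball 0 (real n)" by simp
        then show ?case by (simp add: P_def closest_point_self)
      qed
    qed
    then show "AE t in leb01. (\<lambda>n. (norm (f t - P n (f t)))\<^sup>2) \<longlonglongrightarrow> 0" by simp
  qed (use f P_le in \<open>auto simp: square_integrable_def intro!: power_mono\<close>)
  then have "\<forall>\<^sub>F n in sequentially. (L2norm01 (\<lambda>t. f t - P n (f t)))\<^sup>2 < e"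
    using \<open>0 < e\<close> by (intro order_tendstoD(2)) (simp_all add: L2norm01_power2)
  then obtain n where "(L2norm01 (\<lambda>t. f t - P n (f t)))\<^sup>2 < e"
    by (auto simp: eventually_sequentially)
  then show thesis
    using that[of "\<lambda>t. P n (f t)" "real n"] P by auto
qed

text \<open>A measurable function is an almost everywhere limit of continuous ones; a cutoff vanishing at
  the end points of the interval makes these periodic.\<close>

lemma bounded_approx_continuous_periodic:
  assumes [measurable]: "h \<in> borel_measurable leb01" and K: "\<And>t. norm (h t) \<le> K" "0 \<le> K" and "0 < e"
  obtains g where "continuous_on {0..1} g" "g 0 = g 1" "(L2norm01 (\<lambda>t. h t - g t))\<^sup>2 < e"
proof -
  have "h measurable_on {0..1}"
    by (simp add: measurable_on_iff_borel_measurable)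
  then obtain N G where N: "negligible N" and contG: "\<And>n. continuous_on UNIV (G n)"
    and lim: "\<And>x. x \<notin> N \<Longrightarrow> (\<lambda>n. G n x) \<longlonglongrightarrow> (if x \<in> {0..1} then h x else 0)"
    unfolding measurable_on_def by blast
  define P where "P = closest_point (cball (0::complex) K)"
  have P: "norm (P z) \<le> K" for z
    using closest_point_in_set[of "cball 0 K" z] K by (simp add: P_def)
  have P_self: "P (h t) = h t" for t
    using K by (simp add: P_def closest_point_self)
  have contP: "continuous_on UNIV P"
    unfolding P_def using K by (intro continuous_on_closest_point) auto
  define cut where "cut n t = min 1 (real n * min t (1 - t))" for n :: nat and t :: real
  define g where "g n t = of_real (cut n t) * P (G n t)" for n t
  have contg: "continuous_on {0..1} (g n)" for n
    unfolding g_def cut_def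
    by (intro continuous_intros continuous_on_compose2[OF contP] continuous_on_subset[OF contG]) auto
  have [measurable]: "g n \<in> borel_measurable leb01" for n
    by (intro continuous_imp_measurable_on_sets_lebesgue contg) auto
  have cut: "\<bar>cut n t\<bar> \<le> 1" if "t \<in> {0..1}" for n t
    using that by (auto simp: cut_def min_def)
  have normg: "norm (g n t) \<le> K" if "t \<in> {0..1}" for n t
    using mult_mono[OF cut[OF that] P] K by (simp add: g_def norm_mult)
  have ae_N: "AE t in leb01. t \<notin> N \<union> {0, 1}"
  proof -
    have "negligible (N \<union> {0, 1})" using N by (simp add: negligible_Un)
    then have "AE t in lebesgue. t \<notin> N \<union> {0, 1}"
      by (intro AE_not_in) (simp add: negligible_iff_null_sets)
    then show ?thesis by (subst AE_restrict_space_iff) auto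
  qed
  have lim_g: "(\<lambda>n. (norm (h t - g n t))\<^sup>2) \<longlonglongrightarrow> 0" if "t \<in> {0..1}" "t \<notin> N \<union> {0, 1}" for t
  proof -
    have t: "0 < min t (1 - t)" using that by auto
    have "(\<lambda>n. P (G n t)) \<longlonglongrightarrow> P (h t)"
      using lim[of t] that by (intro continuous_on_tendsto_compose[OF contP]) auto
    moreover have "(\<lambda>n. cut n t) \<longlonglongrightarrow> 1"
    proof (rule tendsto_eventually)
      obtain n0 :: nat where "1 / min t (1 - t) \<le> real n0"
        using real_arch_simple by blast
      then have "1 \<le> real n0 * min t (1 - t)" using t by (simp add: field_simps del: min_less_iff_conj)
      then have "1 \<le> real n * min t (1 - t)" if "n0 \<le> n" for n
        using that t by (meson less_imp_le mult_right_mono of_nat_mono order_trans)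
      then show "\<forall>\<^sub>F n in sequentially. cut n t = 1"
        unfolding eventually_sequentially cut_def by (metis min_absorb1)
    qed
    then have "(\<lambda>n. complex_of_real (cut n t)) \<longlonglongrightarrow> of_real 1" by (rule tendsto_of_real)
    ultimately have "(\<lambda>n. g n t) \<longlonglongrightarrow> of_real 1 * P (h t)"
      unfolding g_def by (intro tendsto_mult)
    then have "(\<lambda>n. (norm (h t - g n t))\<^sup>2) \<longlonglongrightarrow> (norm (h t - of_real 1 * P (h t)))\<^sup>2"
      by (intro tendsto_intros)
    then show ?thesis by (simp add: P_self)
  qed
  have ae: "AE t in leb01. (\<lambda>n. (norm (h t - g n t))\<^sup>2) \<longlonglongrightarrow> 0"
    using ae_N AE_space[of leb01] by eventually_elim (rule lim_g, auto)
  have "(\<lambda>n. integral\<^sup>L leb01 (\<lambda>t. (norm (h t - g n t))\<^sup>2)) \<longlonglongrightarrow> integral\<^sup>L leb01 (\<lambda>t. 0)"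
  proof (rule integral_dominated_convergence[where w = "\<lambda>t. (2 * K)\<^sup>2"])
    show "AE t in leb01. norm ((norm (h t - g n t))\<^sup>2) \<le> (2 * K)\<^sup>2" for n
    proof (rule AE_I2)
      fix t assume "t \<in> space leb01"
      then have "norm (h t - g n t) \<le> 2 * K"
        using norm_triangle_ineq4[of "h t" "g n t"] K(1)[of t] normg[of t n] by simp
      then show "norm ((norm (h t - g n t))\<^sup>2) \<le> (2 * K)\<^sup>2"
        using power_mono[of "norm (h t - g n t)" "2 * K" 2] by simp
    qed
  qed (use ae in auto)
  then have "\<forall>\<^sub>F n in sequentially. (L2norm01 (\<lambda>t. h t - g n t))\<^sup>2 < e"
    using \<open>0 < e\<close> by (intro order_tendstoD(2)) (simp_all add: L2norm01_power2)
  then obtain n where "(L2norm01 (\<lambda>t. h t - g n t))\<^sup>2 < e"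
    by (auto simp: eventually_sequentially)
  moreover have "g n 0 = g n 1" by (simp add: g_def cut_def)
  ultimately show thesis using that contg by blast
qed

lemma square_integrable_approx_trig_poly:
  assumes f: "square_integrable leb01 f" and "0 < e"
  obtains A c where "finite A" "(L2norm01 (\<lambda>t. f t - (\<Sum>n\<in>A. c n * fexp n t)))\<^sup>2 < e"
proof -
  have e16: "0 < e / 16" and e8: "0 < sqrt (e / 8)" using \<open>0 < e\<close> by auto
  obtain K h where h: "h \<in> borel_measurable leb01" "\<And>t. norm (h t) \<le> K" "0 \<le> K"
    and fh: "(L2norm01 (\<lambda>t. f t - h t))\<^sup>2 < e / 16"
    by (rule square_integrable_approx_bounded[OF f e16]) (rule that)
  obtain g where g: "continuous_on {0..1} g" "g 0 = g 1" and hg: "(L2norm01 (\<lambda>t. h t - g t))\<^sup>2 < e / 16"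
    by (rule bounded_approx_continuous_periodic[OF h e16])
  obtain q where "trig_poly q" and q: "\<And>t. t \<in> {0..1} \<Longrightarrow> norm (g t - q t) < sqrt (e / 8)"
    by (rule continuous_periodic_approx_trig_poly[OF g e8]) (rule that)
  from \<open>trig_poly q\<close> obtain A c where A: "finite A" and q_eq: "q = (\<lambda>t. \<Sum>n\<in>A. c n * fexp n t)"
    by (rule trig_poly_imp_sum)
  have sh: "square_integrable leb01 h"
    unfolding square_integrable_def
  proof
    show "integrable leb01 (\<lambda>t. (norm (h t))\<^sup>2)"
      by (rule Bochner_Integration.integrable_bound[of _ "\<lambda>t. K\<^sup>2"])
         (use h in \<open>auto intro!: power_mono\<close>)
  qed (use h in auto)
  have sg: "square_integrable leb01 g" using g(1) by (rule square_integrable_continuous)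
  have sq: "square_integrable leb01 q" unfolding q_eq by (rule square_integrable_fexp_sum)
  have gq: "(L2norm01 (\<lambda>t. g t - q t))\<^sup>2 \<le> e / 8"
    using L2norm01_bound[of "\<lambda>t. g t - q t" "sqrt (e / 8)"] q sg sq \<open>0 < e\<close>
    by (simp add: less_imp_le square_integrable_diff square_integrable_measurable)
  have "(L2norm01 (\<lambda>t. f t - g t))\<^sup>2 < e / 4"
    using L2norm01_triangle_power2[of f h g] fh hg f sh sg by (simp add: square_integrable_diff)
  then have "(L2norm01 (\<lambda>t. f t - q t))\<^sup>2 < e"
    using L2norm01_triangle_power2[of f g q] gq f sg sq \<open>0 < e\<close> by (simp add: square_integrable_diff)
  then show thesis using that A unfolding q_eq by blast
qed

section \<open>Parseval identities\<close>

lemma bessel_inequality: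
  assumes "square_integrable leb01 f" "finite A"
  shows "(\<Sum>n\<in>A. (norm (inner01 f (fexp n)))\<^sup>2) \<le> (L2norm01 f)\<^sup>2"
  using L2norm01_diff_fexp_sum[OF assms, of "\<lambda>n. inner01 f (fexp n)"]
    zero_le_power2[of "L2norm01 (\<lambda>t. f t - (\<Sum>n\<in>A. inner01 f (fexp n) * fexp n t))"]
  by (simp add: sum_negf)

theorem parseval_identity:
  assumes f: "square_integrable leb01 f"
  shows "((\<lambda>n. (norm (inner01 f (fexp n)))\<^sup>2) has_sum (L2norm01 f)\<^sup>2) UNIV"
proof -
  let ?a = "\<lambda>n. (norm (inner01 f (fexp n)))\<^sup>2"
  have summable: "?a summable_on UNIV"
    by (rule nonneg_bdd_above_summable_on)
       (auto intro!: bdd_aboveI[of _ "(L2norm01 f)\<^sup>2"] bessel_inequality[OF f])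
  have "infsum ?a UNIV \<le> (L2norm01 f)\<^sup>2"
    by (rule infsum_le_finite_sums[OF summable]) (rule bessel_inequality[OF f])
  moreover have "(L2norm01 f)\<^sup>2 \<le> infsum ?a UNIV"
  proof (rule field_le_epsilon)
    fix e :: real assume "0 < e"
    then obtain A c where A: "finite A" and lt: "(L2norm01 (\<lambda>t. f t - (\<Sum>n\<in>A. c n * fexp n t)))\<^sup>2 < e"
      using square_integrable_approx_trig_poly[OF f] by blast
    have "0 \<le> (\<Sum>n\<in>A. (norm (inner01 f (fexp n) - c n))\<^sup>2)"
      by (simp add: sum_nonneg)
    then have "(L2norm01 f)\<^sup>2 \<le> sum ?a A + e"
      using L2norm01_diff_fexp_sum[OF f A, of c] lt by (simp add: sum_subtractf)
    also have "sum ?a A \<le> infsum ?a UNIV"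
      by (rule finite_sum_le_infsum[OF summable A]) auto
    finally show "(L2norm01 f)\<^sup>2 \<le> infsum ?a UNIV + e" by simp
  qed
  ultimately show ?thesis
    using has_sum_infsum[OF summable] by simp
qed

lemma fexp_mult_nat: "fexp (m * int k) t = fexp m t ^ k"
  by (induction k) (simp_all add: fexp_add algebra_simps)

lemma fexp_frac_power: "fexp m (real k / real N) = fexp m (1 / real N) ^ k"
  by (simp add: fexp_mult_nat[symmetric]) (simp add: fexp_def mult.assoc)

lemma fexp_self_frac: "0 < N \<Longrightarrow> fexp (int N) (real k / real N) = 1"
  using cis_multiple_2pi[of "real k"] by (simp add: fexp_def mult.assoc)

lemma sum_fexp_frac:
  assumes "\<bar>m\<bar> < int N"
  shows "(\<Sum>k<N. fexp m (real k / real N)) = (if m = 0 then of_nat N else 0)"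
proof (cases "m = 0")
  case False
  define \<omega> where "\<omega> = fexp m (1 / real N)"
  have N: "0 < N" using assms by linarith
  have "\<omega> \<noteq> 1"
  proof
    assume "\<omega> = 1"
    then obtain n :: int where "2 * pi * real_of_int m * (1 / real N) = of_int (2 * n) * pi"
      by (auto simp: \<omega>_def fexp_def cis_conv_exp exp_eq_1)
    then have "real_of_int m = real_of_int (n * int N)"
      using N by (simp add: field_simps)
    then have "m = n * int N" by linarith
    then have "int N \<le> \<bar>m\<bar>"
      using False dvd_imp_le_int[of m "int N"] by simp
    then show False using assms by simp
  qed
  moreover have "\<omega> ^ N = 1"
    using N fexp_frac_power[of m N N] fexp_int_shift[of m 0 1] by (simp add: \<omega>_def fexp_def)
  ultimately have "(\<Sum>k<N. \<omega> ^ k) = 0"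
    by (simp add: geometric_sum)
  moreover have "(\<Sum>k<N. fexp m (real k / real N)) = (\<Sum>k<N. \<omega> ^ k)"
    unfolding \<omega>_def by (intro sum.cong fexp_frac_power refl)
  ultimately show ?thesis using False by simp
qed simp

lemma finite_parseval:
  fixes x :: "nat \<Rightarrow> complex"
  shows "(\<Sum>k<N. (norm (\<Sum>j<N. x j * fexp (int j) (real k / real N)))\<^sup>2) = real N * (\<Sum>j<N. (norm (x j))\<^sup>2)"
proof -
  let ?e = "\<lambda>j k. fexp j (real k / real N)"
  have "complex_of_real (\<Sum>k<N. (norm (\<Sum>j<N. x j * ?e (int j) k))\<^sup>2)
      = (\<Sum>k<N. \<Sum>i<N. \<Sum>j<N. x i * cnj (x j) * ?e (int i - int j) k)"
    unfolding of_real_sum complex_norm_square cnj_sum sum_product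
    by (simp add: cnj_fexp mult_ac) (simp add: fexp_add[symmetric])
  also have "\<dots> = (\<Sum>i<N. \<Sum>j<N. x i * cnj (x j) * (\<Sum>k<N. ?e (int i - int j) k))"
    unfolding sum_distrib_left by (subst sum.swap, rule sum.cong[OF refl], subst sum.swap) simp
  also have "\<dots> = (\<Sum>i<N. \<Sum>j<N. (if j = i then x i * cnj (x i) * of_nat N else 0))"
    by (intro sum.cong refl, subst sum_fexp_frac) auto
  also have "\<dots> = complex_of_real (real N * (\<Sum>j<N. (norm (x j))\<^sup>2))"
    by (simp add: sum_distrib_left complex_norm_square mult_ac del: of_real_power)
  finally show ?thesis by (simp only: of_real_eq_iff)
qed

section \<open>Window-adapted functions\<close>

lemma beta_pos: "0 < beta p"
  by (simp add: beta_def)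

lemma beta_minus [simp]: "beta (- p) = beta p"
  by (simp add: beta_def)

lemma beta_nonzero: "p \<noteq> 0 \<Longrightarrow> beta p = 2 ^ (nat \<bar>p\<bar> - 1)"
  by (auto simp: beta_def)

lemma Epos_eq_fexp_sum:
  "Epos g p \<tau> = (\<lambda>t. \<Sum>j<beta p. (of_real (1 / sqrt (beta p)) * inverse (coef g p j)
      * cnj (fexp (int j) (real \<tau> / beta p))) * fexp (int (beta p + j)) t)"
proof
  fix t
  have "exp (2 * pi * \<i> * of_nat (beta p + j) * complex_of_real (t - real \<tau> / real (beta p)))
     = cnj (fexp (int j) (real \<tau> / beta p)) * fexp (int (beta p + j)) t" for j
  proof -
    have "exp (2 * pi * \<i> * of_nat (beta p + j) * complex_of_real (t - real \<tau> / real (beta p)))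
      = fexp (int (beta p + j)) t * cnj (fexp (int (beta p + j)) (real \<tau> / beta p))"
    proof -
      have "exp (2 * pi * \<i> * of_nat (beta p + j) * complex_of_real (t - real \<tau> / real (beta p)))
        = cis (2 * pi * real (beta p + j) * (t - real \<tau> / real (beta p)))"
        by (simp add: cis_conv_exp mult_ac)
      then show ?thesis
        by (simp add: fexp_def cis_cnj cis_mult right_diff_distrib)
    qed
    also have "fexp (int (beta p + j)) (real \<tau> / beta p) = fexp (int j) (real \<tau> / beta p)"
      by (simp add: fexp_add fexp_self_frac beta_pos)
    finally show ?thesis by (simp add: mult.commute)
  qed
  then show "Epos g p \<tau> t = (\<Sum>j<beta p. (of_real (1 / sqrt (beta p)) * inverse (coef g p j)
      * cnj (fexp (int j) (real \<tau> / beta p))) * fexp (int (beta p + j)) t)"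
    unfolding Epos_def by (simp only: sum_distrib_left mult.assoc)
qed

lemma L2norm01_Epos:
  "(L2norm01 (Epos g p \<tau>))\<^sup>2 = (\<Sum>j<beta p. (norm (inverse (coef g p j)))\<^sup>2) / beta p"
proof -
  let ?N = "beta p"
  define c where "c j = of_real (1 / sqrt ?N) * inverse (coef g p j) * cnj (fexp (int j) (real \<tau> / ?N))" for j
  have inj: "inj_on (\<lambda>j. int (?N + j)) {..<?N}" by (auto intro: inj_onI)
  have "Epos g p \<tau> = (\<lambda>t. \<Sum>n\<in>(\<lambda>j. int (?N + j)) ` {..<?N}. c (nat n - ?N) * fexp n t)"
    unfolding Epos_eq_fexp_sum c_def[symmetric] sum.reindex[OF inj] o_def nat_int by simp
  then have "(L2norm01 (Epos g p \<tau>))\<^sup>2 = (\<Sum>n\<in>(\<lambda>j. int (?N + j)) ` {..<?N}. (norm (c (nat n - ?N)))\<^sup>2)"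
    by (simp only: L2norm01_fexp_sum finite_imageI finite_lessThan)
  also have "\<dots> = (\<Sum>j<?N. (norm (c j))\<^sup>2)"
    unfolding sum.reindex[OF inj] o_def nat_int by simp
  also have "\<dots> = (\<Sum>j<?N. (norm (inverse (coef g p j)))\<^sup>2) / ?N"
    unfolding sum_divide_distrib
    by (rule sum.cong) (simp_all add: c_def norm_mult norm_divide divide_simps)
  finally show ?thesis .
qed

lemma sum_inner01_Epos:
  assumes f: "square_integrable leb01 f"
  shows "(\<Sum>\<tau><beta p. (norm (inner01 f (Epos g p \<tau>)))\<^sup>2)
    = (\<Sum>j<beta p. (norm (inverse (coef g p j)))\<^sup>2 * (norm (inner01 f (fexp (int (beta p + j)))))\<^sup>2)"
proof -
  let ?N = "beta p"
  define x where "x j = of_real (1 / sqrt ?N) * cnj (inverse (coef g p j)) * inner01 f (fexp (int (?N + j)))" for j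
  have "inner01 f (Epos g p \<tau>) = (\<Sum>j<?N. x j * fexp (int j) (real \<tau> / ?N))" for \<tau>
    unfolding Epos_eq_fexp_sum x_def
    by (subst inner01_sum_right) (simp_all add: f square_integrable_fexp mult_ac)
  then have "(\<Sum>\<tau><?N. (norm (inner01 f (Epos g p \<tau>)))\<^sup>2) = ?N * (\<Sum>j<?N. (norm (x j))\<^sup>2)"
    by (simp only: finite_parseval)
  also have "\<dots> = (\<Sum>j<?N. (norm (inverse (coef g p j)))\<^sup>2 * (norm (inner01 f (fexp (int (?N + j)))))\<^sup>2)"
    unfolding sum_distrib_left using beta_pos[of p]
    by (intro sum.cong refl) (simp add: x_def norm_mult norm_divide norm_inverse power_mult_distrib power_divide)
  finally show ?thesis .
qed

lemma inner01_divide_right: "inner01 f (\<lambda>t. h t / of_real c) = inner01 f h / of_real c"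
  unfolding inner01_def by simp

text \<open>Normalising divides the weights by their average, so the quotient is controlled
  by the ratio of the extreme weights.\<close>

lemma weighted_average_bounds:
  fixes w a :: "nat \<Rightarrow> real"
  assumes "0 < l" "0 < N" and w: "\<And>j. j < N \<Longrightarrow> l \<le> w j \<and> w j \<le> u" and a: "\<And>j. 0 \<le> a j"
  shows "l / u * (\<Sum>j<N. a j) \<le> (\<Sum>j<N. w j * a j) / ((\<Sum>j<N. w j) / N)"
    and "(\<Sum>j<N. w j * a j) / ((\<Sum>j<N. w j) / N) \<le> u / l * (\<Sum>j<N. a j)"
proof -
  let ?W = "(\<Sum>j<N. w j) / N"
  have "N * l \<le> (\<Sum>j<N. w j)" "(\<Sum>j<N. w j) \<le> N * u"
    using sum_bounded_below[of "{..<N}" l w] sum_bounded_above[of "{..<N}" w u] w by auto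
  then have W: "l \<le> ?W" "?W \<le> u"
    using \<open>0 < N\<close> by (auto simp: field_simps)
  have S: "l * (\<Sum>j<N. a j) \<le> (\<Sum>j<N. w j * a j)" "(\<Sum>j<N. w j * a j) \<le> u * (\<Sum>j<N. a j)"
    unfolding sum_distrib_left using w a by (auto intro!: sum_mono mult_right_mono)
  have a0: "0 \<le> (\<Sum>j<N. a j)" using a by (simp add: sum_nonneg)
  have "l * (\<Sum>j<N. a j) / u \<le> (\<Sum>j<N. w j * a j) / ?W"
    using W S a0 \<open>0 < l\<close> by (intro frac_le) (auto intro: order_trans[OF _ S(1)])
  then show "l / u * (\<Sum>j<N. a j) \<le> (\<Sum>j<N. w j * a j) / ?W" by simp
  have "(\<Sum>j<N. w j * a j) / ?W \<le> u * (\<Sum>j<N. a j) / l"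
    using W S a0 \<open>0 < l\<close> by (intro frac_le) auto
  then show "(\<Sum>j<N. w j * a j) / ?W \<le> u / l * (\<Sum>j<N. a j)" by simp
qed

lemma phat_ext_bounds:
  assumes lim: "\<exists>L. (g \<longlongrightarrow> L) (at_right (-1/3))"
    and lower: "\<forall>\<xi>\<in>{-1/3<..<1/3}. \<delta> \<le> norm (g \<xi>)"
    and upper: "\<forall>\<xi>\<in>{-1/3<..<1/3}. norm (g \<xi>) \<le> M"
    and x: "-1/3 \<le> x" "x < 1/3"
  shows "\<delta> \<le> norm (phat_ext g x) \<and> norm (phat_ext g x) \<le> M"
proof (cases "x = -1/3")
  case True
  from lim obtain L where L: "(g \<longlongrightarrow> L) (at_right (-1/3))" ..
  have "Lim (at_right (-1/3)) g = L"
    using L by (intro tendsto_Lim) auto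
  then have "phat_ext g x = L" using True by (simp add: phat_ext_def)
  moreover have ev: "\<forall>\<^sub>F \<xi> in at_right (-1/3::real). \<xi> \<in> {-1/3<..<1/3}"
    by (rule eventually_at_right_real) simp
  have "\<delta> \<le> norm L"
    by (rule tendsto_lowerbound[OF tendsto_norm[OF L]]) (use ev lower in \<open>auto elim: eventually_mono\<close>)
  moreover have "norm L \<le> M"
    by (rule tendsto_upperbound[OF tendsto_norm[OF L]]) (use ev upper in \<open>auto elim: eventually_mono\<close>)
  ultimately show ?thesis by simp
next
  case False
  then show ?thesis using x lower upper by (simp add: phat_ext_def)
qed

lemma coef_argument_bounds:
  assumes "0 < p" "j < beta p"
  shows "-1/3 \<le> (real (beta p) + real j) / real_of_int (nu p) - 1"
    and "(real (beta p) + real j) / real_of_int (nu p) - 1 < 1/3"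
proof -
  have "-1/3 \<le> (real (beta p) + real j) / real_of_int (nu p) - 1
    \<and> (real (beta p) + real j) / real_of_int (nu p) - 1 < 1/3"
  proof (cases "p = 1")
    case True
    then show ?thesis using assms by (simp add: beta_def nu_def)
  next
    case False
    then obtain k where k: "nat \<bar>p\<bar> = k + 2" 
      using assms that[of "nat p - 2"] by (simp add: le_diff_conv2)
    have b: "real (beta p) = 2 * 2 ^ k" using k False assms by (simp add: beta_def)
    have n: "real_of_int (nu p) = 3 * 2 ^ k" using k False assms by (simp add: nu_def)
    have "real j < 2 * 2 ^ k" using assms(2) b by linarith
    then show ?thesis unfolding b n by (simp add: field_simps)
  qed
  then show "-1/3 \<le> (real (beta p) + real j) / real_of_int (nu p) - 1"
    and "(real (beta p) + real j) / real_of_int (nu p) - 1 < 1/3" by auto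
qed

definition block_freq :: "int \<Rightarrow> nat \<Rightarrow> int" where
  "block_freq p j = sgn p * int (beta p + j)"

lemma block_freq_bounds:
  assumes "p \<noteq> 0" "j < beta p"
  shows "2 ^ (nat \<bar>p\<bar> - 1) \<le> nat \<bar>block_freq p j\<bar>" "nat \<bar>block_freq p j\<bar> < 2 ^ Suc (nat \<bar>p\<bar> - 1)"
    and "sgn (block_freq p j) = sgn p"
proof -
  have "nat \<bar>block_freq p j\<bar> = beta p + j"
    using assms by (simp add: block_freq_def abs_mult sgn_if)
  then show "2 ^ (nat \<bar>p\<bar> - 1) \<le> nat \<bar>block_freq p j\<bar>" "nat \<bar>block_freq p j\<bar> < 2 ^ Suc (nat \<bar>p\<bar> - 1)"
    using assms(2) unfolding beta_nonzero[OF assms(1)] power_Suc by linarith+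
  show "sgn (block_freq p j) = sgn p"
    using beta_pos[of p] by (simp add: block_freq_def sgn_mult)
qed

lemma bij_betw_block_freq:
  "bij_betw (\<lambda>(p, j). block_freq p j) (Sigma UNIV (\<lambda>p. {..<beta p})) UNIV"
  unfolding bij_betw_def
proof
  show "inj_on (\<lambda>(p, j). block_freq p j) (Sigma UNIV (\<lambda>p. {..<beta p}))"
  proof (rule inj_onI, clarsimp)
    fix p q j k assume *: "j < beta p" "k < beta q" "block_freq p j = block_freq q k"
    show "p = q \<and> j = k"
    proof (cases "p = 0 \<or> q = 0")
      case True
      then have "p = 0" "q = 0"
        using * beta_pos[of p] beta_pos[of q] by (auto simp: block_freq_def sgn_if split: if_splits)
      then show ?thesis using * by (simp add: beta_def)
    next
      case False
      then have "p \<noteq> 0" "q \<noteq> 0" by auto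
      note P = block_freq_bounds[OF \<open>p \<noteq> 0\<close> *(1)] and Q = block_freq_bounds[OF \<open>q \<noteq> 0\<close> *(2)]
      have "(2::nat) ^ (nat \<bar>p\<bar> - 1) < 2 ^ Suc (nat \<bar>q\<bar> - 1)" "(2::nat) ^ (nat \<bar>q\<bar> - 1) < 2 ^ Suc (nat \<bar>p\<bar> - 1)"
        using P(1,2) Q(1,2) unfolding *(3) by (blast intro: le_less_trans)+
      then have "nat \<bar>p\<bar> - 1 < Suc (nat \<bar>q\<bar> - 1)" "nat \<bar>q\<bar> - 1 < Suc (nat \<bar>p\<bar> - 1)"
        by (simp_all only: power_strict_increasing_iff one_less_numeral_iff semiring_norm)
      then have "\<bar>p\<bar> = \<bar>q\<bar>" using False by linarith
      moreover have "sgn p = sgn q" using P(3) Q(3) * False by simp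
      ultimately have "p = q" by (metis abs_mult_sgn)
      then show ?thesis using * False by (auto simp: block_freq_def sgn_if split: if_splits)
    qed
  qed
  show "(\<lambda>(p, j). block_freq p j) ` Sigma UNIV (\<lambda>p. {..<beta p}) = UNIV"
  proof (rule UNIV_eq_I[symmetric])
    fix n :: int
    show "n \<in> (\<lambda>(p, j). block_freq p j) ` Sigma UNIV (\<lambda>p. {..<beta p})"
    proof (cases "n = 0")
      case True
      then show ?thesis
        by (intro image_eqI[of _ _ "(0, 0)"]) (auto simp: block_freq_def beta_def)
    next
      case False
      then have "1 \<le> nat \<bar>n\<bar>" by simp
      then obtain m where m: "2 ^ m \<le> nat \<bar>n\<bar>" "nat \<bar>n\<bar> < 2 ^ (m + 1)"
        using ex_power_ivl1[of 2 "nat \<bar>n\<bar>"] by blast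
      define p where "p = sgn n * int (Suc m)"
      have "p \<noteq> 0" "nat \<bar>p\<bar> = Suc m" "sgn p = sgn n"
        using False by (auto simp: p_def sgn_if)
      then have p: "p \<noteq> 0" "sgn p = sgn n" "beta p = 2 ^ m"
        by (simp_all add: beta_nonzero)
      have "block_freq p (nat \<bar>n\<bar> - beta p) = sgn n * \<bar>n\<bar>"
        using p m by (simp add: block_freq_def)
      then show ?thesis
        using p m by (intro image_eqI[of _ _ "(p, nat \<bar>n\<bar> - beta p)"]) (auto simp: mult_sgn_abs)
    qed
  qed
qed

lemma block_frame_bounds_pos:
  assumes lim: "\<exists>L. (g \<longlongrightarrow> L) (at_right (-1/3))"
    and "0 < \<delta>"
    and lower: "\<forall>\<xi>\<in>{-1/3<..<1/3}. \<delta> \<le> norm (g \<xi>)"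
    and upper: "\<forall>\<xi>\<in>{-1/3<..<1/3}. norm (g \<xi>) \<le> M"
    and f: "square_integrable leb01 f" and p: "0 < p"
  defines "A \<equiv> \<Sum>j<beta p. (norm (inner01 f (fexp (block_freq p j))))\<^sup>2"
    and "S \<equiv> \<Sum>\<tau><beta p. (norm (inner01 f (Fwin g p \<tau>)))\<^sup>2"
  shows "(\<delta> / M)\<^sup>2 * A \<le> S \<and> S \<le> (M / \<delta>)\<^sup>2 * A"
proof -
  let ?N = "beta p"
  define w where "w j = (norm (inverse (coef g p j)))\<^sup>2" for j
  define W where "W = (\<Sum>j<?N. w j) / ?N"
  have "0 < M"
    using bspec[OF lower, of 0] bspec[OF upper, of 0] \<open>0 < \<delta>\<close> by auto
  have w: "1 / M\<^sup>2 \<le> w j \<and> w j \<le> 1 / \<delta>\<^sup>2" if "j < ?N" for j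
  proof -
    have "\<delta> \<le> norm (coef g p j)" "norm (coef g p j) \<le> M"
      using phat_ext_bounds[OF lim lower upper coef_argument_bounds[OF p that]]
      by (auto simp: coef_def)
    moreover have "w j = 1 / (norm (coef g p j))\<^sup>2"
      by (simp add: w_def norm_inverse power_inverse divide_inverse)
    ultimately show ?thesis
      using \<open>0 < \<delta>\<close>
      by (auto intro!: divide_left_mono power_mono mult_pos_pos zero_less_power)
  qed
  have "S = (\<Sum>\<tau><?N. (norm (inner01 f (Epos g p \<tau>)))\<^sup>2) / W"
    unfolding S_def sum_divide_distrib
  proof (rule sum.cong[OF refl])
    fix \<tau>
    have "Fwin g p \<tau> = (\<lambda>t. Epos g p \<tau> t / of_real (L2norm01 (Epos g p \<tau>)))"
      using p by (simp add: Fwin_def[abs_def] Ewin_def[abs_def])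
    then have "(norm (inner01 f (Fwin g p \<tau>)))\<^sup>2 = (norm (inner01 f (Epos g p \<tau>)))\<^sup>2 / (L2norm01 (Epos g p \<tau>))\<^sup>2"
      by (simp add: inner01_divide_right norm_divide power_divide)
    then show "(norm (inner01 f (Fwin g p \<tau>)))\<^sup>2 = (norm (inner01 f (Epos g p \<tau>)))\<^sup>2 / W"
      by (simp add: L2norm01_Epos W_def w_def)
  qed
  then have "S = (\<Sum>j<?N. w j * (norm (inner01 f (fexp (block_freq p j))))\<^sup>2) / W"
    using p by (simp add: sum_inner01_Epos[OF f] w_def block_freq_def)
  then show ?thesis
    using weighted_average_bounds[of "1 / M\<^sup>2" ?N w "1 / \<delta>\<^sup>2" "\<lambda>j. (norm (inner01 f (fexp (block_freq p j))))\<^sup>2"]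
      w beta_pos[of p] \<open>0 < M\<close> \<open>0 < \<delta>\<close>
    by (simp add: A_def W_def power_divide)
qed

lemma inner01_cnj: "inner01 (\<lambda>t. cnj (f t)) (\<lambda>t. cnj (g t)) = cnj (inner01 f g)"
  unfolding inner01_def Bochner_Integration.integral_cnj[symmetric] by simp

lemma block_frame_bounds:
  assumes lim: "\<exists>L. (g \<longlongrightarrow> L) (at_right (-1/3))"
    and "0 < \<delta>"
    and lower: "\<forall>\<xi>\<in>{-1/3<..<1/3}. \<delta> \<le> norm (g \<xi>)"
    and upper: "\<forall>\<xi>\<in>{-1/3<..<1/3}. norm (g \<xi>) \<le> M"
    and f: "square_integrable leb01 f"
  defines "A \<equiv> \<lambda>p. \<Sum>j<beta p. (norm (inner01 f (fexp (block_freq p j))))\<^sup>2"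
    and "S \<equiv> \<lambda>p. \<Sum>\<tau><beta p. (norm (inner01 f (Fwin g p \<tau>)))\<^sup>2"
  shows "(\<delta> / M)\<^sup>2 * A p \<le> S p \<and> S p \<le> (M / \<delta>)\<^sup>2 * A p"
proof (cases p "0 :: int" rule: linorder_cases)
  case greater
  then show ?thesis
    using block_frame_bounds_pos[OF lim \<open>0 < \<delta>\<close> lower upper f] by (simp add: A_def S_def)
next
  case equal
  have "Fwin g 0 0 = (\<lambda>t. 1)" "fexp 0 = (\<lambda>t. 1)"
    by (auto simp: Fwin_def Ewin_def L2norm01_def)
  then have "A p = S p" "0 \<le> A p"
    using equal by (auto simp: A_def S_def block_freq_def beta_def)
  moreover have "\<delta> \<le> M"
    using bspec[OF lower, of 0] bspec[OF upper, of 0] by auto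
  ultimately show ?thesis
    using \<open>0 < \<delta>\<close> mult_right_mono[of "(\<delta> / M)\<^sup>2" 1 "A p"] mult_right_mono[of 1 "(M / \<delta>)\<^sup>2" "A p"]
    by (simp add: power_le_one)
next
  case less
  have Ewin: "Ewin g p \<tau> = (\<lambda>t. cnj (Ewin g (- p) \<tau> t))" for \<tau>
    using less by (auto simp: Ewin_def)
  have "L2norm01 (Ewin g p \<tau>) = L2norm01 (Ewin g (- p) \<tau>)" for \<tau>
    by (simp add: L2norm01_def Ewin)
  then have F: "Fwin g p \<tau> = (\<lambda>t. cnj (Fwin g (- p) \<tau> t))" for \<tau>
    by (simp add: Fwin_def[abs_def] Ewin)
  have "norm (inner01 f (Fwin g p \<tau>)) = norm (inner01 (\<lambda>t. cnj (f t)) (Fwin g (- p) \<tau>))" for \<tau>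
    using inner01_cnj[of f "Fwin g p \<tau>"] by (simp add: F)
  moreover have "norm (inner01 f (fexp (block_freq p j)))
      = norm (inner01 (\<lambda>t. cnj (f t)) (fexp (block_freq (- p) j)))" for j
    using inner01_cnj[of f "fexp (block_freq p j)"] by (simp add: cnj_fexp block_freq_def sgn_minus eta_contract_eq)
  ultimately show ?thesis
    using block_frame_bounds_pos[OF lim \<open>0 < \<delta>\<close> lower upper square_integrable_cnj[OF f], of "- p"] less
    by (simp add: A_def S_def)
qed

theorem theorem6p5:
  fixes phihat :: "real \<Rightarrow> complex" and \<delta> M :: real and f :: "real \<Rightarrow> complex"
  assumes meas: "phihat \<in> borel_measurable lborel"
    and Linf: "\<exists>B. AE \<xi> in lborel. norm (phihat \<xi>) \<le> B"
    and cont: "continuous_on {-1/3<..<1/3} phihat"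
    and nz: "\<forall>\<xi>\<in>{-1/3<..<1/3}. phihat \<xi> \<noteq> 0"
    and supp: "AE \<xi> in lborel. \<bar>\<xi>\<bar> > 1/3 \<longrightarrow> phihat \<xi> = 0"
    and lim: "\<exists>L. (phihat \<longlongrightarrow> L) (at_right (-1/3))"
    and \<delta>pos: "\<delta> > 0"
    and lower: "\<forall>\<xi>\<in>{-1/3<..<1/3}. \<delta> \<le> norm (phihat \<xi>)"
    and upper: "\<forall>\<xi>\<in>{-1/3<..<1/3}. norm (phihat \<xi>) \<le> M"
    and fmeas: "f \<in> borel_measurable (lebesgue_on {0..1})"
    and fL2: "integrable (lebesgue_on {0..1}) (\<lambda>t. (norm (f t))\<^sup>2)"
  shows "(\<lambda>(p, \<tau>). (norm (inner01 f (Fwin phihat p \<tau>)))\<^sup>2) summable_on {(p, \<tau>). \<tau> < beta p}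
    \<and> (\<delta> / M)\<^sup>2 * (L2norm01 f)\<^sup>2
        \<le> (\<Sum>\<^sub>\<infinity>(p, \<tau>)\<in>{(p, \<tau>). \<tau> < beta p}. (norm (inner01 f (Fwin phihat p \<tau>)))\<^sup>2)
    \<and> (\<Sum>\<^sub>\<infinity>(p, \<tau>)\<in>{(p, \<tau>). \<tau> < beta p}. (norm (inner01 f (Fwin phihat p \<tau>)))\<^sup>2)
        \<le> (M / \<delta>)\<^sup>2 * (L2norm01 f)\<^sup>2"
proof -
  define I where "I = Sigma UNIV (\<lambda>p. {..<beta p})"
  have I: "{(p, \<tau>). \<tau> < beta p} = I" by (auto simp: I_def)
  define A where "A p = (\<Sum>j<beta p. (norm (inner01 f (fexp (block_freq p j))))\<^sup>2)" for p
  define S where "S p = (\<Sum>\<tau><beta p. (norm (inner01 f (Fwin phihat p \<tau>)))\<^sup>2)" for p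
  define s where "s = (\<lambda>(p, \<tau>). (norm (inner01 f (Fwin phihat p \<tau>)))\<^sup>2)"
  have f: "square_integrable leb01 f"
    using fmeas fL2 by (simp add: square_integrable_def)
  have bounds: "(\<delta> / M)\<^sup>2 * A p \<le> S p" "S p \<le> (M / \<delta>)\<^sup>2 * A p" for p
    using block_frame_bounds[OF lim \<delta>pos lower upper f, of p] by (auto simp: A_def S_def)
  have "((\<lambda>(p, j). (norm (inner01 f (fexp (block_freq p j))))\<^sup>2) has_sum (L2norm01 f)\<^sup>2) I"
    using parseval_identity[OF f]
    unfolding has_sum_reindex_bij_betw[OF bij_betw_block_freq, symmetric] I_def
    by (simp add: case_prod_unfold)
  then have A: "(A has_sum (L2norm01 f)\<^sup>2) UNIV"
    unfolding I_def by (rule has_sum_SigmaD) (auto simp: A_def intro!: has_sum_finiteI)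
  have S_nonneg: "0 \<le> S p" for p
    by (simp add: S_def sum_nonneg)
  have "S summable_on UNIV"
    using summable_on_cmult_right[OF has_sum_imp_summable[OF A]] bounds(2) S_nonneg
    by (rule summable_on_comparison_test)
  moreover have sS: "((\<lambda>\<tau>. s (p, \<tau>)) has_sum S p) {..<beta p}" for p
    by (auto simp: s_def S_def intro!: has_sum_finiteI)
  ultimately have s: "s summable_on I"
    unfolding I_def by (intro summable_on_SigmaI) (auto simp: s_def)
  then have S: "(S has_sum infsum s I) UNIV"
    unfolding I_def by (intro has_sum_SigmaD[OF has_sum_infsum sS])
  have "(\<delta> / M)\<^sup>2 * (L2norm01 f)\<^sup>2 \<le> infsum s I"
    using has_sum_cmult_right[OF A] S bounds(1) by (rule has_sum_mono)
  moreover have "infsum s I \<le> (M / \<delta>)\<^sup>2 * (L2norm01 f)\<^sup>2"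
    using S has_sum_cmult_right[OF A] bounds(2) by (rule has_sum_mono)
  ultimately show ?thesis
    using s unfolding I s_def by blast
qed

end
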